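(* Let $N\ge 1$ and consider a cascade of $N$ identical turbines with stochastic actuator disk dynamics $$x_{k+1}=a_kx_k+b_ku_k,\qquad k=0,\dots,N-1,$$ where $x_0$ is the free stream velocity entering the cascade, and $a_k,b_k$ are real random variables, independent for all $k$ and independent of each other. The distributions of $a_k$ and $b_k$ are described by their raw moments up to third order: means $\mu_{a,k}=\mathbf E[a_k]$, $\mu_{b,k}=\mathbf E[b_k]$, second raw moments $\Sigma_{a,k}=\mathbf E[a_k^2]$, $\Sigma_{b,k}=\mathbf E[b_k^2]$, and third raw moments $\Gamma_{a,k}=\mathbf E[a_k^3]$, $\Gamma_{b,k}=\mathbf E[b_k^3]$. Consider the multi-stage stochastic optimal control problem $$\max_{\pi_0,\dots,\pi_{N-1}}\ \mathbf E\sum_{k=0}^{N-1}(x_k-u_k)^2u_k,\qquad u_k=\pi_k(x_k)\in[0,\tfrac12x_k],$$ over state feedback policies $\pi_k$. Then the optimal feedback control policies are linear in the state and given by $$u_k^*=\pi_k^*(x_k)=\psi_kx_k,\qquad k=0,\dots,N-1,$$ where $\psi_k$ and $Q_k$ are given by the backward recursion, for $k=N-1,\dots,0$ with initialization $Q_N=0$, $$\psi_k=-\frac{3Q_{k+1}\Sigma_{b,k}\mu_{a,k}-2+\sqrt{(3Q_{k+1}\Sigma_{b,k}\mu_{a,k}-2)^2-3(Q_{k+1}\Gamma_{b,k}+1)(3Q_{k+1}\Sigma_{a,k}\mu_{b,k}+1)}}{3(Q_{k+1}\Gamma_{b,k}+1)},$$ $$Q_k=(1-\psi_k)^2\psi_k+Q_{k+1}\left(\Gamma_{a,k}+\Gamma_{b,k}\psi_k^3+3\Sigma_{b,k}\mu_{a,k}\psi_k^2+3\Sigma_{a,k}\mu_{b,k}\psi_k\right).$$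 Moreover, the maximum (expected) power produced by the wind farm, as a function of the initial upstream wind velocity, is $$P_0^*(x_0)=2\rho A\,Q_0\,x_0^3,$$ where $\rho$ is the air density and $A$ is the rotor swept area.
   Context: The state $x_k\ge 0$ is the wind velocity upstream of turbine $k$ ($k=0$ is the most upstream turbine), and the scalar control $u_k$ is the velocity deficit at the rotor disk, constrained by $u_k\in[0,\frac12x_k]$. The power extracted by turbine $k$ is $2\rho A(x_k-u_k)^2u_k$ with constants $\rho,A>0$, so the farm power is $2\rho A\sum_{k=0}^{N-1}(x_k-u_k)^2u_k$, and $P_0^*(x_0)$ is the maximum of its expectation over policies, starting from $x_0$. The expectation is over the sequences $a_k,b_k$. Optimality is in the sense of dynamic programming: with $G_N^*\equiv 0$, $$G_k^*(x)=\max_{u\in[0,\frac12x]}\left\{(x-u)^2u+\mathbf E\left[G_{k+1}^*(a_kx+b_ku)\right]\right\},$$ $\pi_k^*(x)$ is the maximizer, and $G_k^*(x)$ is the optimal normalized expected power from turbines $k,\dots,N-1$ when $x_k=x$.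
   Formalization: Added, since the formula can be undefined or fail for general a_k, b_k: Q_{k+1}Γ_{b,k}+1 ≠ 0 for every k<N, and for x>0 every maximizer in the dynamic programming recursion lies strictly inside [0, x/2] (so endpoint optima and ties are excluded). *)

theory Defs
  imports "HOL-Probability.Probability"
begin

text \<open>
  Turbines are numbered by \<open>k < N\<close>. The random coefficients are families
  \<open>a, b :: nat \<Rightarrow> 'w \<Rightarrow> real\<close> on a probability space \<open>M\<close>, and a state feedback policy is a
  family \<open>\<pi> :: nat \<Rightarrow> real \<Rightarrow> real\<close> with \<open>u\<^sub>k = \<pi> k x\<^sub>k\<close>.
\<close>

primrec cascade_state ::
  "(nat \<Rightarrow> 'w \<Rightarrow> real) \<Rightarrow> (nat \<Rightarrow> 'w \<Rightarrow> real) \<Rightarrow> (nat \<Rightarrow> real \<Rightarrow> real) \<Rightarrow> real \<Rightarrow> nat \<Rightarrow> 'w \<Rightarrow> real"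
where
  "cascade_state a b \<pi> x0 0 = (\<lambda>\<omega>. x0)"
| "cascade_state a b \<pi> x0 (Suc k) =
     (\<lambda>\<omega>. a k \<omega> * cascade_state a b \<pi> x0 k \<omega> + b k \<omega> * \<pi> k (cascade_state a b \<pi> x0 k \<omega>))"

definition power_sum ::
  "nat \<Rightarrow> (nat \<Rightarrow> 'w \<Rightarrow> real) \<Rightarrow> (nat \<Rightarrow> 'w \<Rightarrow> real) \<Rightarrow> (nat \<Rightarrow> real \<Rightarrow> real) \<Rightarrow> real \<Rightarrow> 'w \<Rightarrow> real"
where
  "power_sum N a b \<pi> x0 \<omega> =
     (\<Sum>k<N. let x = cascade_state a b \<pi> x0 k \<omega>; u = \<pi> k x in (x - u)\<^sup>2 * u)"

text \<open>
  Wind velocities are nonnegative, so the control constraint is imposed for \<open>x \<ge> 0\<close> only (the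
  interval \<open>{0..x/2}\<close> is empty for \<open>x < 0\<close>). Measurability makes the expected power meaningful.
\<close>

definition admissible_policy :: "nat \<Rightarrow> (nat \<Rightarrow> real \<Rightarrow> real) \<Rightarrow> bool" where
  "admissible_policy N \<pi> \<longleftrightarrow>
     (\<forall>k<N. \<pi> k \<in> borel_measurable borel \<and> (\<forall>x\<ge>0. \<pi> k x \<in> {0..x/2}))"

definition max_farm_power ::
  "'w measure \<Rightarrow> real \<Rightarrow> real \<Rightarrow> nat \<Rightarrow> (nat \<Rightarrow> 'w \<Rightarrow> real) \<Rightarrow> (nat \<Rightarrow> 'w \<Rightarrow> real) \<Rightarrow> real \<Rightarrow> real"
where
  "max_farm_power M \<rho> A N a b x0 =
     (SUP \<pi>\<in>{\<pi>. admissible_policy N \<pi>}.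
        prob_space.expectation M (\<lambda>\<omega>. 2 * \<rho> * A * power_sum N a b \<pi> x0 \<omega>))"

text \<open>
  The dynamic programming recursion, with the maximum over \<open>u\<close> rendered as a supremum;
  attainment is not built into the definition.
\<close>

function dp_value ::
  "'w measure \<Rightarrow> (nat \<Rightarrow> 'w \<Rightarrow> real) \<Rightarrow> (nat \<Rightarrow> 'w \<Rightarrow> real) \<Rightarrow> nat \<Rightarrow> nat \<Rightarrow> real \<Rightarrow> real"
where
  "dp_value M a b N k x =
     (if k < N
      then (SUP u\<in>{0..x/2}. (x - u)\<^sup>2 * u +
              prob_space.expectation M (\<lambda>\<omega>. dp_value M a b N (Suc k) (a k \<omega> * x + b k \<omega> * u)))
      else 0)"
  by auto
termination
  by (relation "Wellfounded.measure (\<lambda>(M, a, b, N, k, x). N - k)") auto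

declare dp_value.simps [simp del]

definition dp_objective ::
  "'w measure \<Rightarrow> (nat \<Rightarrow> 'w \<Rightarrow> real) \<Rightarrow> (nat \<Rightarrow> 'w \<Rightarrow> real) \<Rightarrow> nat \<Rightarrow> nat \<Rightarrow> real \<Rightarrow> real \<Rightarrow> real"
where
  "dp_objective M a b N k x u =
     (x - u)\<^sup>2 * u +
     prob_space.expectation M (\<lambda>\<omega>. dp_value M a b N (Suc k) (a k \<omega> * x + b k \<omega> * u))"

definition dp_maximizer ::
  "'w measure \<Rightarrow> (nat \<Rightarrow> 'w \<Rightarrow> real) \<Rightarrow> (nat \<Rightarrow> 'w \<Rightarrow> real) \<Rightarrow> nat \<Rightarrow> nat \<Rightarrow> real \<Rightarrow> real \<Rightarrow> bool"
where
  "dp_maximizer M a b N k x u \<longleftrightarrow>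
     is_arg_max (dp_objective M a b N k x) (\<lambda>u. u \<in> {0..x/2}) u"

end

theory Submission
  imports Defs
begin

text \<open>
  Every stage of the dynamic program is a homogeneous cubic in \<open>(x, u)\<close>, so by backward induction
  the value function is \<open>Q k * x ^ 3\<close>. An interior maximizer of a cubic is the stationary point with
  nonpositive second derivative, which is the root \<open>\<psi> k\<close> of the quadratic. The state \<open>x\<^sub>k\<close> is a function
  of the coefficients before \<open>k\<close>, hence independent of \<open>a k\<close> and \<open>b k\<close>; so the expected stage power
  plus \<open>Q (k + 1) * E [x\<^sub>k\<^sub>+\<^sub>1\<^sup>3]\<close> is at most \<open>Q k * E [x\<^sub>k\<^sup>3]\<close>, with equality for the linear policy,
  and the sum telescopes.
\<close>

section \<open>Interior maximizers of cubics\<close>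

text \<open>The sign of \<open>c\<close> is unknown, so the right root is selected by concavity. At
  a stationary point, \<open>h s - h t\<close> is \<open>(s - t)\<^sup>2\<close> times an affine
  function of \<open>s\<close> whose value at \<open>t\<close> is half the second derivative.
  Maximality makes that value nonpositive, which fixes the sign of the square root.\<close>

lemma cubic_interior_maximizer:
  fixes c d p r t l m :: real
  defines "h \<equiv> \<lambda>s. d + r * s + p * s\<^sup>2 + c * s ^ 3"
  assumes "c \<noteq> 0" and t: "l < t" "t < m" and max: "\<And>s. s \<in> {l..m} \<Longrightarrow> h s \<le> h t"
  shows "t = - (p + sqrt (p\<^sup>2 - 3 * c * r)) / (3 * c)"
proof -
  have "(h has_real_derivative r + 2 * p * t + 3 * c * t\<^sup>2) (at t)"
    unfolding h_def by (auto intro!: derivative_eq_intros simp: power2_eq_square)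
  then have stat: "r + 2 * p * t + 3 * c * t\<^sup>2 = 0"
    by (rule DERIV_local_max[where d = "min (t - l) (m - t)"]) (use t in \<open>auto intro!: max\<close>)
  have expand: "h s - h t = (s - t)\<^sup>2 * (p + 3 * c * t + c * (s - t))" for s
  proof -
    have r: "r = - 2 * p * t - 3 * c * t\<^sup>2"
      using stat by simp
    show ?thesis
      unfolding h_def r by (simp add: power2_eq_square power3_eq_cube algebra_simps)
  qed
  have near: "p + 3 * c * t + c * (s - t) \<le> 0" if "s \<in> {l..m}" "s \<noteq> t" for s
    using max[OF that(1)] expand[of s] that(2) by (smt (verit) mult_pos_pos zero_less_power2)
  have concave: "p + 3 * c * t \<le> 0"
  \<comment> \<open>The endpoint is chosen so that \<open>c * (s - t)\<close> is positive; dropping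
    this term from \<open>near\<close> leaves the bound on \<open>p + 3 * c * t\<close>.\<close>
  proof (cases "c > 0")
    case True
    then have "c * (m - t) > 0" using t by simp
    then show ?thesis using near[of m] t by auto
  next
    case False
    then have "c * (l - t) > 0" using t \<open>c \<noteq> 0\<close> by (simp add: mult_neg_neg)
    then show ?thesis using near[of l] t by auto
  qed
  \<comment> \<open>Completing the square at \<open>t\<close>: the bracket multiplied by
    \<open>3 * c\<close> is the derivative at \<open>t\<close>, which vanishes.\<close>
  have "p\<^sup>2 - 3 * c * r = (p + 3 * c * t)\<^sup>2 - 3 * c * (r + 2 * p * t + 3 * c * t\<^sup>2)"
    by (simp add: power2_eq_square algebra_simps)
  then have "sqrt (p\<^sup>2 - 3 * c * r) = - (p + 3 * c * t)"
    using stat concave by simp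
  then show ?thesis using \<open>c \<noteq> 0\<close> by simp
qed

section \<open>Moments and independence\<close>

text \<open>A lower power is dominated by \<open>1 + \<bar>y\<bar> ^ m\<close>, and constants are
  integrable on a probability space. Third moments thus yield the first and second ones.\<close>

lemma (in prob_space) integrable_power_le:
  fixes f :: "'a \<Rightarrow> real"
  assumes "f \<in> borel_measurable M" "integrable M (\<lambda>\<omega>. f \<omega> ^ m)" "n \<le> m"
  shows "integrable M (\<lambda>\<omega>. f \<omega> ^ n)"
proof (rule Bochner_Integration.integrable_bound)
  show "integrable M (\<lambda>\<omega>. 1 + \<bar>f \<omega> ^ m\<bar>)"
    using assms by simp
  have "\<bar>y\<bar> ^ n \<le> 1 + \<bar>y\<bar> ^ m" for y :: real
  proof (cases "\<bar>y\<bar> \<le> 1")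
    case True
    then show ?thesis
      by (intro order_trans[OF power_le_one]) auto
  next
    case False
    then show ?thesis
      using power_increasing[OF assms(3), of "\<bar>y\<bar>"] by linarith
  qed
  then show "AE \<omega> in M. norm (f \<omega> ^ n) \<le> norm (1 + \<bar>f \<omega> ^ m\<bar>)"
    by (simp add: power_abs)
qed (use assms in simp)

text \<open>Functions of disjoint blocks of an independent family are independent, and expectations
  of their products factor. The three blocks \<open>J\<close>, \<open>{p}\<close> and
  \<open>{q}\<close> are numbered 0, 1, 2 so that they form a single indexed family;
  \<open>J\<close> will hold the past coefficients, \<open>p\<close> and \<open>q\<close> the two
  current ones.\<close>

lemma (in prob_space) indep_vars_prod_past:
  fixes X :: "'i \<Rightarrow> 'a \<Rightarrow> real" and H :: "('i \<Rightarrow> real) \<Rightarrow> real"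
  assumes ind: "indep_vars (\<lambda>_. borel) X I"
    and sub: "J \<subseteq> I" "p \<in> I" "q \<in> I" "p \<notin> J" "q \<notin> J" "p \<noteq> q"
    and H: "H \<in> borel_measurable (PiM J (\<lambda>_. borel))"
    and fg: "f \<in> borel_measurable borel" "g \<in> borel_measurable borel"
    and int: "integrable M (\<lambda>\<omega>. f (X p \<omega>))" "integrable M (\<lambda>\<omega>. g (X q \<omega>))"
      "integrable M (\<lambda>\<omega>. H (\<lambda>i\<in>J. X i \<omega>))"
  shows "integrable M (\<lambda>\<omega>. f (X p \<omega>) * g (X q \<omega>) * H (\<lambda>i\<in>J. X i \<omega>))" (is ?int)
    and "expectation (\<lambda>\<omega>. f (X p \<omega>) * g (X q \<omega>) * H (\<lambda>i\<in>J. X i \<omega>)) =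
      expectation (\<lambda>\<omega>. f (X p \<omega>)) * expectation (\<lambda>\<omega>. g (X q \<omega>)) *
      expectation (\<lambda>\<omega>. H (\<lambda>i\<in>J. X i \<omega>))" (is ?eq)
proof -
  define K where "K n = (if n = (0::nat) then J else if n = 1 then {p} else {q})" for n
  define F where "F n v = (if n = (0::nat) then H v else if n = 1 then f (v p) else g (v q))" for n v
  define Z where "Z n \<omega> = F n (\<lambda>i\<in>K n. X i \<omega>)" for n \<omega>
  let ?L = "{0, 1, 2::nat}"
  have Z: "Z 0 \<omega> = H (\<lambda>i\<in>J. X i \<omega>)" "Z 1 \<omega> = f (X p \<omega>)" "Z 2 \<omega> = g (X q \<omega>)" for \<omega>
    by (simp_all add: Z_def F_def K_def)
  have F: "F n \<in> borel_measurable (PiM (K n) (\<lambda>_. borel))" if "n \<in> ?L" for n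
    using that H fg by (auto simp: F_def[abs_def] K_def)
  have "indep_vars (\<lambda>n. PiM (K n) (\<lambda>_. borel)) (\<lambda>n \<omega>. \<lambda>i\<in>K n. X i \<omega>) ?L"
    by (rule indep_vars_restrict[OF ind])
      (use sub in \<open>auto simp: K_def disjoint_family_on_def\<close>)
  from indep_vars_compose2[OF this F]
  have indZ: "indep_vars (\<lambda>_. borel) Z ?L"
    unfolding Z_def by simp
  have intZ: "integrable M (Z n)" if "n \<in> ?L" for n
    using that int by (auto simp: Z simp flip: One_nat_def cong: Bochner_Integration.integrable_cong)
  have prod: "(\<Prod>n\<in>?L. Z n \<omega>) = f (X p \<omega>) * g (X q \<omega>) * H (\<lambda>i\<in>J. X i \<omega>)" for \<omega>
    by (simp add: Z mult_ac flip: One_nat_def)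
  show ?int
    using indep_vars_integrable[OF _ indZ intZ] unfolding prod by simp
  show ?eq
    using indep_vars_lebesgue_integral[OF _ indZ intZ]
    unfolding prod by (simp add: Z[abs_def] mult_ac del: One_nat_def)
qed

section \<open>The cascade and its standing hypotheses\<close>

text \<open>Indexing by a disjoint sum makes all \<open>a k\<close> and \<open>b k\<close> jointly
  independent as one family. \<open>state_nonneg\<close> keeps the state where the value is
  \<open>Q k * x ^ 3\<close>, \<open>denom_nonzero\<close> makes each stage a genuine cubic in the
  control, and \<open>constraint_inactive\<close> places its maximizers where the derivative
  vanishes.\<close>

locale turbine_cascade = prob_space M for M :: "'w measure" +
  fixes N :: nat and a b :: "nat \<Rightarrow> 'w \<Rightarrow> real"
    and \<mu>a \<mu>b \<Sigma>a \<Sigma>b \<Gamma>a \<Gamma>b \<psi> Q :: "nat \<Rightarrow> real"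
  assumes indep: "indep_vars (\<lambda>_. borel) (case_sum a b) ({..<N} <+> {..<N})"
    and third_moments: "\<And>k. k < N \<Longrightarrow> integrable M (\<lambda>\<omega>. a k \<omega> ^ 3)"
      "\<And>k. k < N \<Longrightarrow> integrable M (\<lambda>\<omega>. b k \<omega> ^ 3)"
    and state_nonneg: "\<And>k x u. k < N \<Longrightarrow> x \<ge> 0 \<Longrightarrow> u \<in> {0..x/2} \<Longrightarrow>
      AE \<omega> in M. 0 \<le> a k \<omega> * x + b k \<omega> * u"
    and means: "\<And>k. k < N \<Longrightarrow> \<mu>a k = expectation (a k)"
      "\<And>k. k < N \<Longrightarrow> \<mu>b k = expectation (b k)"
    and second: "\<And>k. k < N \<Longrightarrow> \<Sigma>a k = expectation (\<lambda>\<omega>. a k \<omega> ^ 2)"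
      "\<And>k. k < N \<Longrightarrow> \<Sigma>b k = expectation (\<lambda>\<omega>. b k \<omega> ^ 2)"
    and third: "\<And>k. k < N \<Longrightarrow> \<Gamma>a k = expectation (\<lambda>\<omega>. a k \<omega> ^ 3)"
      "\<And>k. k < N \<Longrightarrow> \<Gamma>b k = expectation (\<lambda>\<omega>. b k \<omega> ^ 3)"
    and Q_N: "Q N = 0"
    and \<psi>_rec: "\<And>k. k < N \<Longrightarrow> \<psi> k =
      - (3 * Q (Suc k) * \<Sigma>b k * \<mu>a k - 2
         + sqrt ((3 * Q (Suc k) * \<Sigma>b k * \<mu>a k - 2)\<^sup>2
                 - 3 * (Q (Suc k) * \<Gamma>b k + 1) * (3 * Q (Suc k) * \<Sigma>a k * \<mu>b k + 1)))
      / (3 * (Q (Suc k) * \<Gamma>b k + 1))"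
    and Q_rec: "\<And>k. k < N \<Longrightarrow> Q k =
      (1 - \<psi> k)\<^sup>2 * \<psi> k
      + Q (Suc k) * (\<Gamma>a k + \<Gamma>b k * \<psi> k ^ 3 + 3 * \<Sigma>b k * \<mu>a k * \<psi> k ^ 2 + 3 * \<Sigma>a k * \<mu>b k * \<psi> k)"
    and denom_nonzero: "\<And>k. k < N \<Longrightarrow> Q (Suc k) * \<Gamma>b k + 1 \<noteq> 0"
    and constraint_inactive: "\<And>k x u. k < N \<Longrightarrow> x > 0 \<Longrightarrow> dp_maximizer M a b N k x u \<Longrightarrow> 0 < u \<and> u < x/2"
begin

lemma measurable_coeffs [measurable]:
  assumes "k < N"
  shows "a k \<in> borel_measurable M" "b k \<in> borel_measurable M"
proof -
  have "\<forall>i\<in>{..<N} <+> {..<N}. random_variable borel (case_sum a b i)"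
    using indep by (simp add: indep_vars_def)
  from bspec[OF this, of "Inl k"] bspec[OF this, of "Inr k"]
  show "a k \<in> borel_measurable M" "b k \<in> borel_measurable M"
    using assms by auto
qed

text \<open>The constraint \<open>u \<in> {0..x/2}\<close> cuts out the cone spanned by \<open>(2, 0)\<close> and \<open>(2, 1)\<close>, so two null sets
  suffice for all \<open>x\<close> and \<open>u\<close> at once.\<close>

lemma AE_next_state_nonneg:
  assumes "k < N"
  shows "AE \<omega> in M. \<forall>x u. 0 \<le> x \<longrightarrow> u \<in> {0..x/2} \<longrightarrow> 0 \<le> a k \<omega> * x + b k \<omega> * u"
proof -
  have "AE \<omega> in M. 0 \<le> a k \<omega> * 2 + b k \<omega> * 0" "AE \<omega> in M. 0 \<le> a k \<omega> * 2 + b k \<omega> * 1"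
    by (rule state_nonneg[OF assms]; simp)+
  then show ?thesis
  proof eventually_elim
    case (elim \<omega>)
    show ?case
    proof (intro allI impI)
      fix x u :: real
      assume "0 \<le> x" and u: "u \<in> {0..x/2}"
      have "0 \<le> a k \<omega> * (x - 2 * u)" "0 \<le> (a k \<omega> * 2 + b k \<omega>) * u"
        by (rule mult_nonneg_nonneg; use elim u in simp)+
      then show "0 \<le> a k \<omega> * x + b k \<omega> * u"
        by (simp add: algebra_simps)
    qed
  qed
qed

section \<open>Dependence on the past coefficients\<close>

definition coeffs_before :: "nat \<Rightarrow> 'w \<Rightarrow> nat + nat \<Rightarrow> real" where
  "coeffs_before k \<omega> = (\<lambda>i\<in>{..<k} <+> {..<k}. case_sum a b i \<omega>)"

text \<open>An explicit factorization through the coefficient vector replaces measurability with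
  respect to the generated sigma-algebra; the factor \<open>H\<close> is what the block independence
  result takes as input.\<close>

definition past_determined :: "nat \<Rightarrow> ('w \<Rightarrow> real) \<Rightarrow> bool" where
  "past_determined k Y \<longleftrightarrow>
     (\<exists>H\<in>borel_measurable (PiM ({..<k} <+> {..<k}) (\<lambda>_. borel)). Y = (\<lambda>\<omega>. H (coeffs_before k \<omega>)))"

lemma past_determined_const: "past_determined k (\<lambda>_. c)"
  unfolding past_determined_def by (rule bexI[of _ "\<lambda>_. c"]) auto

lemma past_determined_compose:
  assumes "past_determined k Y" "g \<in> borel_measurable borel"
  shows "past_determined k (\<lambda>\<omega>. g (Y \<omega>))"
proof -
  obtain H where "H \<in> borel_measurable (PiM ({..<k} <+> {..<k}) (\<lambda>_. borel))"
    "Y = (\<lambda>\<omega>. H (coeffs_before k \<omega>))"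
    using assms(1) unfolding past_determined_def by blast
  then show ?thesis
    unfolding past_determined_def
    by (intro bexI[of _ "\<lambda>v. g (H v)"]) (auto intro: measurable_compose[OF _ assms(2)])
qed

lemma past_determined_measurable:
  assumes "past_determined k Y" "k \<le> N"
  shows "Y \<in> borel_measurable M"
proof -
  have "coeffs_before k \<in> measurable M (PiM ({..<k} <+> {..<k}) (\<lambda>_. borel))"
    unfolding coeffs_before_def using \<open>k \<le> N\<close>
    by (intro measurable_restrict) (auto split: sum.split)
  then show ?thesis
    using assms(1) unfolding past_determined_def by (auto intro: measurable_compose)
qed

text \<open>The factor is the cascade itself, run on the product space with the coordinate
  projections as coefficients.\<close>

lemma past_determined_cascade_state:
  assumes "\<And>j. j < k \<Longrightarrow> \<pi> j \<in> borel_measurable borel"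
  shows "past_determined k (cascade_state a b \<pi> x0 k)"
proof -
  let ?S = "cascade_state (\<lambda>i v. v (Inl i)) (\<lambda>i v. v (Inr i)) \<pi> x0"
  have meas: "?S j \<in> borel_measurable (PiM ({..<k} <+> {..<k}) (\<lambda>_. borel))" if "j \<le> k" for j
    using that
  proof (induction j)
    case (Suc j)
    then have IH [measurable]: "?S j \<in> borel_measurable (PiM ({..<k} <+> {..<k}) (\<lambda>_. borel))"
      by simp
    have [measurable]: "\<pi> j \<in> borel_measurable borel"
      using Suc assms by simp
    have [measurable]:
      "(\<lambda>v. v (Inl j)) \<in> borel_measurable (PiM ({..<k} <+> {..<k}) (\<lambda>_. borel :: real measure))"
      "(\<lambda>v. v (Inr j)) \<in> borel_measurable (PiM ({..<k} <+> {..<k}) (\<lambda>_. borel :: real measure))"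
      using Suc by (auto intro!: measurable_component_singleton)
    show ?case by simp
  qed simp
  have eq: "cascade_state a b \<pi> x0 j \<omega> = ?S j (coeffs_before k \<omega>)" if "j \<le> k" for j \<omega>
    using that by (induction j) (auto simp: coeffs_before_def)
  show ?thesis
    unfolding past_determined_def using meas eq by blast
qed

text \<open>\<open>Y\<close> depends only on coefficients before \<open>k\<close>, so it is
  independent of \<open>a k\<close> and \<open>b k\<close>, and the expectation splits into three
  factors.\<close>

lemma expectation_monomial:
  assumes k: "k < N" and Y: "past_determined k Y" "integrable M Y" and ij: "i \<le> 3" "j \<le> 3"
  shows "integrable M (\<lambda>\<omega>. a k \<omega> ^ i * b k \<omega> ^ j * Y \<omega>)"
    and "expectation (\<lambda>\<omega>. a k \<omega> ^ i * b k \<omega> ^ j * Y \<omega>) =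
      expectation (\<lambda>\<omega>. a k \<omega> ^ i) * expectation (\<lambda>\<omega>. b k \<omega> ^ j) * expectation Y"
proof -
  note [measurable] = measurable_coeffs[OF k]
  obtain H where H: "H \<in> borel_measurable (PiM ({..<k} <+> {..<k}) (\<lambda>_. borel))"
    and YH: "Y = (\<lambda>\<omega>. H (coeffs_before k \<omega>))"
    using Y(1) unfolding past_determined_def by blast
  have int: "integrable M (\<lambda>\<omega>. a k \<omega> ^ i)" "integrable M (\<lambda>\<omega>. b k \<omega> ^ j)"
    using k ij by (auto intro!: integrable_power_le[where m = 3] third_moments)
  note * = indep_vars_prod_past[OF indep, of "{..<k} <+> {..<k}" "Inl k" "Inr k" H "\<lambda>y. y ^ i" "\<lambda>y. y ^ j",
      folded coeffs_before_def, OF _ _ _ _ _ _ H]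
  have sub: "{..<k} <+> {..<k} \<subseteq> {..<N} <+> {..<N}"
    using k by auto
  show "integrable M (\<lambda>\<omega>. a k \<omega> ^ i * b k \<omega> ^ j * Y \<omega>)"
    "expectation (\<lambda>\<omega>. a k \<omega> ^ i * b k \<omega> ^ j * Y \<omega>) =
      expectation (\<lambda>\<omega>. a k \<omega> ^ i) * expectation (\<lambda>\<omega>. b k \<omega> ^ j) * expectation Y"
    using * sub k int Y(2) unfolding YH by auto
qed

section \<open>The one-stage objective\<close>

text \<open>This is the Bellman objective when the next value function is
  \<open>Q (Suc k) * y ^ 3\<close>: the second summand comes from expanding the cube of the next
  state and taking moments.\<close>

definition stage :: "nat \<Rightarrow> real \<Rightarrow> real \<Rightarrow> real" where
  "stage k x u = (x - u)\<^sup>2 * u + Q (Suc k) *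
     (\<Gamma>a k * x ^ 3 + 3 * \<Sigma>a k * \<mu>b k * (x\<^sup>2 * u) + 3 * \<Sigma>b k * \<mu>a k * (x * u\<^sup>2) + \<Gamma>b k * u ^ 3)"

text \<open>The constraint gives \<open>0 \<le> g y \<le> y\<close>, so every cubic monomial in
  state and control is dominated by the cube of the state. The cube of the next state is then
  expanded and integrated term by term. A constant \<open>Y\<close> serves the dynamic program, and
  \<open>Y\<close> equal to the state serves the evaluation of a policy.\<close>

lemma stage_expectation:
  assumes k: "k < N" and Y: "past_determined k Y" and g: "g \<in> borel_measurable borel"
    and nonneg: "AE \<omega> in M. 0 \<le> Y \<omega>" and constr: "\<And>y. 0 \<le> y \<Longrightarrow> g y \<in> {0..y/2}"
    and int: "integrable M (\<lambda>\<omega>. Y \<omega> ^ 3)"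
  shows "integrable M (\<lambda>\<omega>. (Y \<omega> - g (Y \<omega>))\<^sup>2 * g (Y \<omega>))" (is ?int1)
    and "integrable M (\<lambda>\<omega>. (a k \<omega> * Y \<omega> + b k \<omega> * g (Y \<omega>)) ^ 3)" (is ?int2)
    and "integrable M (\<lambda>\<omega>. stage k (Y \<omega>) (g (Y \<omega>)))" (is ?int3)
    and "expectation (\<lambda>\<omega>. stage k (Y \<omega>) (g (Y \<omega>))) =
      expectation (\<lambda>\<omega>. (Y \<omega> - g (Y \<omega>))\<^sup>2 * g (Y \<omega>)) +
      Q (Suc k) * expectation (\<lambda>\<omega>. (a k \<omega> * Y \<omega> + b k \<omega> * g (Y \<omega>)) ^ 3)" (is ?eq)
proof -
  note [measurable] = g measurable_coeffs[OF k] past_determined_measurable[OF Y less_imp_le[OF k]]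
  have bounded: "integrable M (\<lambda>\<omega>. f (Y \<omega>))"
    if "f \<in> borel_measurable borel" "\<And>y. 0 \<le> y \<Longrightarrow> \<bar>f y\<bar> \<le> y ^ 3" for f :: "real \<Rightarrow> real"
  proof (rule Bochner_Integration.integrable_bound[OF int])
    show "AE \<omega> in M. norm (f (Y \<omega>)) \<le> norm (Y \<omega> ^ 3)"
      using nonneg by eventually_elim (use that(2) in fastforce)
  qed (use that(1) in measurable)
  have gb: "0 \<le> g y" "g y \<le> y" if "0 \<le> y" for y
    using constr[OF that] that by auto
  let ?U = "\<lambda>\<omega>. g (Y \<omega>)"
  have mono: "integrable M (\<lambda>\<omega>. (Y \<omega>)\<^sup>2 * ?U \<omega>)" "integrable M (\<lambda>\<omega>. Y \<omega> * (?U \<omega>)\<^sup>2)" "integrable M (\<lambda>\<omega>. ?U \<omega> ^ 3)"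
    using gb by (auto intro!: bounded mult_mono power_mono mult_left_mono
        simp: power2_eq_square power3_eq_cube abs_mult mult.assoc)
  show int1: ?int1
  proof (rule bounded)
    fix y :: real assume y: "0 \<le> y"
    have "(y - g y)\<^sup>2 * g y \<le> y\<^sup>2 * y"
      using gb[OF y] by (intro mult_mono power_mono) auto
    then show "\<bar>(y - g y)\<^sup>2 * g y\<bar> \<le> y ^ 3"
      using gb[OF y] by (simp add: power2_eq_square power3_eq_cube abs_mult)
  qed measurable
  have past: "past_determined k (\<lambda>\<omega>. Y \<omega> ^ 3)" "past_determined k (\<lambda>\<omega>. (Y \<omega>)\<^sup>2 * ?U \<omega>)"
    "past_determined k (\<lambda>\<omega>. Y \<omega> * (?U \<omega>)\<^sup>2)" "past_determined k (\<lambda>\<omega>. ?U \<omega> ^ 3)"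
    by (rule past_determined_compose[OF Y]; measurable)+
  \<comment> \<open>The exponent pairs of \<open>a k\<close> and \<open>b k\<close> are those of the
    four terms of the binomial cube.\<close>
  note m = expectation_monomial[OF k past(1) int, of 3 0] expectation_monomial[OF k past(2) mono(1), of 2 1]
    expectation_monomial[OF k past(3) mono(2), of 1 2] expectation_monomial[OF k past(4) mono(3), of 0 3]
  have cube: "(a k \<omega> * Y \<omega> + b k \<omega> * ?U \<omega>) ^ 3 =
      a k \<omega> ^ 3 * Y \<omega> ^ 3 + 3 * (a k \<omega> ^ 2 * b k \<omega> * ((Y \<omega>)\<^sup>2 * ?U \<omega>))
      + 3 * (a k \<omega> * b k \<omega> ^ 2 * (Y \<omega> * (?U \<omega>)\<^sup>2)) + b k \<omega> ^ 3 * ?U \<omega> ^ 3" for \<omega>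
    by (simp add: power2_eq_square power3_eq_cube algebra_simps)
  show int2: ?int2
    unfolding cube using m by simp
  have E: "expectation (\<lambda>\<omega>. (a k \<omega> * Y \<omega> + b k \<omega> * ?U \<omega>) ^ 3) =
     \<Gamma>a k * expectation (\<lambda>\<omega>. Y \<omega> ^ 3) + 3 * \<Sigma>a k * \<mu>b k * expectation (\<lambda>\<omega>. (Y \<omega>)\<^sup>2 * ?U \<omega>)
     + 3 * \<Sigma>b k * \<mu>a k * expectation (\<lambda>\<omega>. Y \<omega> * (?U \<omega>)\<^sup>2) + \<Gamma>b k * expectation (\<lambda>\<omega>. ?U \<omega> ^ 3)"
    unfolding cube using m k by (simp add: means second third prob_space)
  show ?int3
    unfolding stage_def using int1 int mono by simp
  show ?eq
    unfolding E stage_def using int1 int mono by simp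
qed

section \<open>Maximizing one stage and backward induction\<close>

text \<open>The next state is almost surely nonnegative, so the arbitrary value \<open>C\<close> at
  negative states does not affect the expectation.\<close>

lemma dp_objective_eq_stage:
  assumes k: "k < N" and x: "0 \<le> x" and u: "u \<in> {0..x/2}"
    and dp: "\<And>y. dp_value M a b N (Suc k) y = (if 0 \<le> y then Q (Suc k) * y ^ 3 else C)"
  shows "dp_objective M a b N k x u = stage k x u"
proof -
  note [measurable] = measurable_coeffs[OF k]
  have "expectation (\<lambda>\<omega>. dp_value M a b N (Suc k) (a k \<omega> * x + b k \<omega> * u)) =
    expectation (\<lambda>\<omega>. Q (Suc k) * (a k \<omega> * x + b k \<omega> * u) ^ 3)"
    unfolding dp
  proof (rule integral_cong_AE)
    show "AE \<omega> in M. (if 0 \<le> a k \<omega> * x + b k \<omega> * u then Q (Suc k) * (a k \<omega> * x + b k \<omega> * u) ^ 3 else C) =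
       Q (Suc k) * (a k \<omega> * x + b k \<omega> * u) ^ 3"
      using state_nonneg[OF k x u] by eventually_elim simp
  qed measurable
  moreover have "stage k x u = (x - u)\<^sup>2 * u + Q (Suc k) * expectation (\<lambda>\<omega>. (a k \<omega> * x + b k \<omega> * u) ^ 3)"
  proof -
    \<comment> \<open>A constant feedback \<open>u\<close> would violate the constraint at small
      \<open>y\<close>; this one satisfies it everywhere and equals \<open>u\<close> at the only
      state that occurs.\<close>
    define g where "g y = (if y = x then u else 0)" for y
    have "g \<in> borel_measurable borel" "\<And>y. 0 \<le> y \<Longrightarrow> g y \<in> {0..y/2}" "g x = u"
      unfolding g_def using u by auto
    then show ?thesis
      using stage_expectation(4)[OF k past_determined_const[of k x], of g] x by (simp add: prob_space)
  qed
  ultimately show ?thesis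
    unfolding dp_objective_def by simp
qed

text \<open>Reduces each stage to \<open>x = 1\<close>, which is why the optimal policy is linear
  and the value cubic.\<close>

lemma stage_homogeneous: "stage k (x * y) (x * u) = x ^ 3 * stage k y u"
  unfolding stage_def by (simp add: power2_eq_square power3_eq_cube algebra_simps)

text \<open>Every maximizer on the unit problem is interior by \<open>constraint_inactive\<close>,
  hence equals \<open>\<psi> k\<close> by the cubic formula. A second point reaching
  \<open>Q k\<close> would also be a maximizer, so the inequality is strict. The hypothesis
  \<open>obj\<close> is supplied later by the backward induction.\<close>

lemma stage_unit_maximizer:
  assumes k: "k < N"
    and obj: "\<And>x u. 0 \<le> x \<Longrightarrow> u \<in> {0..x/2} \<Longrightarrow> dp_objective M a b N k x u = stage k x u"
  shows "0 < \<psi> k" "\<psi> k < 1/2" "stage k 1 (\<psi> k) = Q k"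
    and "\<And>t. t \<in> {0..1/2} \<Longrightarrow> t \<noteq> \<psi> k \<Longrightarrow> stage k 1 t < Q k"
proof -
  have unique: "0 < t \<and> t < 1/2 \<and> t = \<psi> k" if t: "t \<in> {0..1/2}" "\<forall>s\<in>{0..1/2}. stage k 1 s \<le> stage k 1 t" for t
  proof -
    have "dp_maximizer M a b N k 1 t"
      using t obj[of 1] by (auto simp: dp_maximizer_def is_arg_max_def not_less)
    then have t': "0 < t" "t < 1/2"
      using constraint_inactive[OF k, of 1 t] by auto
    \<comment> \<open>The summands \<open>1\<close>, \<open>-2\<close> and \<open>1\<close> in the
      coefficients come from \<open>(1 - s)\<^sup>2 * s\<close>; the coefficients are the ones in
      the recursion for \<open>\<psi> k\<close>.\<close>
    have poly: "stage k 1 s = Q (Suc k) * \<Gamma>a k + (3 * Q (Suc k) * \<Sigma>a k * \<mu>b k + 1) * s +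
        (3 * Q (Suc k) * \<Sigma>b k * \<mu>a k - 2) * s\<^sup>2 + (Q (Suc k) * \<Gamma>b k + 1) * s ^ 3" for s
      unfolding stage_def by (simp add: power2_eq_square power3_eq_cube algebra_simps)
    have "t = \<psi> k"
      unfolding \<psi>_rec[OF k]
      by (rule cubic_interior_maximizer[where d = "Q (Suc k) * \<Gamma>a k", OF denom_nonzero[OF k] t'])
        (use t(2) in \<open>unfold poly, blast\<close>)
    with t' show ?thesis by simp
  qed
  \<comment> \<open>The formula alone does not place \<open>\<psi> k\<close> in the interval;
    compactness provides some maximizer, which \<open>unique\<close> then identifies with
    it.\<close>
  have "continuous_on {0..1/2} (stage k 1)"
    unfolding stage_def by (intro continuous_intros)
  then have "\<exists>t\<in>{0..1/2}. \<forall>s\<in>{0..1/2}. stage k 1 s \<le> stage k 1 t"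
    by (intro continuous_attains_sup) auto
  with unique have max: "0 < \<psi> k" "\<psi> k < 1/2" "\<forall>s\<in>{0..1/2}. stage k 1 s \<le> stage k 1 (\<psi> k)"
    by blast+
  then show "0 < \<psi> k" "\<psi> k < 1/2" by auto
  show val: "stage k 1 (\<psi> k) = Q k"
    unfolding stage_def Q_rec[OF k] by (simp add: algebra_simps)
  show "stage k 1 t < Q k" if t: "t \<in> {0..1/2}" "t \<noteq> \<psi> k" for t
  proof (rule ccontr)
    assume "\<not> stage k 1 t < Q k"
    then have "\<forall>s\<in>{0..1/2}. stage k 1 s \<le> stage k 1 t"
      using max(3) val by force
    with unique t show False by blast
  qed
qed

lemma stage_maximizer:
  assumes k: "k < N"
    and obj: "\<And>x u. 0 \<le> x \<Longrightarrow> u \<in> {0..x/2} \<Longrightarrow> dp_objective M a b N k x u = stage k x u"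
    and x: "0 \<le> x"
  shows "\<psi> k * x \<in> {0..x/2}" "stage k x (\<psi> k * x) = Q k * x ^ 3"
    and "\<And>u. u \<in> {0..x/2} \<Longrightarrow> u \<noteq> \<psi> k * x \<Longrightarrow> stage k x u < Q k * x ^ 3"
proof -
  note max = stage_unit_maximizer[OF k obj]
  show "\<psi> k * x \<in> {0..x/2}"
    using mult_right_mono[OF less_imp_le[OF max(2)] x] max(1) x by auto
  show "stage k x (\<psi> k * x) = Q k * x ^ 3"
    using stage_homogeneous[of k x 1 "\<psi> k"] max(3) by (simp add: mult.commute)
  show "stage k x u < Q k * x ^ 3" if u: "u \<in> {0..x/2}" "u \<noteq> \<psi> k * x" for u
  proof -
    \<comment> \<open>At \<open>x = 0\<close> the control interval is \<open>{0}\<close>, so no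
      competing \<open>u\<close> exists.\<close>
    have "x > 0" using x u by (cases "x = 0") auto
    then have "stage k 1 (u / x) < Q k"
      using u by (intro max(4)) (auto simp: field_simps)
    then show ?thesis
      using stage_homogeneous[of k x 1 "u / x"] \<open>x > 0\<close> by (simp add: mult.commute)
  qed
qed

text \<open>For negative \<open>x\<close> and \<open>k < N\<close> the supremum ranges over the empty set; its junk value does not depend
  on \<open>x\<close>.\<close>

lemma dp_value_eq:
  assumes "k \<le> N"
  shows "\<exists>C. \<forall>y. dp_value M a b N k y = (if 0 \<le> y then Q k * y ^ 3 else C)"
  using assms
proof (induction k rule: inc_induct)
  case base
  show ?case
    by (intro exI[of _ 0]) (simp add: dp_value.simps[of M a b N N] Q_N)
next
  case (step k)
  then obtain C where C: "\<And>y. dp_value M a b N (Suc k) y = (if 0 \<le> y then Q (Suc k) * y ^ 3 else C)"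
    by blast
  note obj = dp_objective_eq_stage[OF step.hyps(2) _ _ C]
  have rec: "dp_value M a b N k y = (SUP u\<in>{0..y/2}. dp_objective M a b N k y u)" for y
    using step.hyps by (simp add: dp_value.simps[of M a b N k] dp_objective_def)
  have "dp_value M a b N k y = (if 0 \<le> y then Q k * y ^ 3 else Sup {})" for y
  proof (cases "0 \<le> y")
    case True
    note max = stage_maximizer[OF step.hyps(2) obj True]
    have "(SUP u\<in>{0..y/2}. dp_objective M a b N k y u) = Q k * y ^ 3"
    proof (rule cSup_eq_maximum)
      show "Q k * y ^ 3 \<in> dp_objective M a b N k y ` {0..y/2}"
        using max(1,2) obj[OF True max(1)] by (intro image_eqI[of _ _ "\<psi> k * y"]) auto
      show "z \<le> Q k * y ^ 3" if "z \<in> dp_objective M a b N k y ` {0..y/2}" for z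
        using that obj[OF True] max(2) max(3) by (fastforce simp: less_le)
    qed
    with True show ?thesis by (simp add: rec)
  qed (simp add: rec)
  then show ?case by blast
qed

text \<open>With the value function known at every stage, this discharges the hypothesis
  \<open>obj\<close> of the preceding results.\<close>

lemma dp_objective_eq:
  assumes "k < N" "0 \<le> x" "u \<in> {0..x/2}"
  shows "dp_objective M a b N k x u = stage k x u"
proof -
  obtain C where "\<And>y. dp_value M a b N (Suc k) y = (if 0 \<le> y then Q (Suc k) * y ^ 3 else C)"
    using dp_value_eq[of "Suc k"] assms(1) by auto
  from dp_objective_eq_stage[OF assms this] show ?thesis .
qed

lemma stage_max:
  assumes "k < N" "0 \<le> x"
  shows "\<psi> k * x \<in> {0..x/2}" "stage k x (\<psi> k * x) = Q k * x ^ 3"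
    and "\<And>u. u \<in> {0..x/2} \<Longrightarrow> u \<noteq> \<psi> k * x \<Longrightarrow> stage k x u < Q k * x ^ 3"
  using stage_maximizer[OF assms(1) dp_objective_eq[OF assms(1)] assms(2)] by auto

lemma stage_le:
  assumes "k < N" "0 \<le> x" "u \<in> {0..x/2}"
  shows "stage k x u \<le> Q k * x ^ 3"
  using stage_max(2)[OF assms(1,2)] stage_max(3)[OF assms]
  by (cases "u = \<psi> k * x") auto

lemma dp_maximizer_iff:
  assumes k: "k < N" and x: "0 \<le> x"
  shows "dp_maximizer M a b N k x u \<longleftrightarrow> u = \<psi> k * x"
proof -
  note max = stage_max[OF k x]
  have "u = \<psi> k * x" if "dp_maximizer M a b N k x u"
  proof (rule ccontr)
    assume "u \<noteq> \<psi> k * x"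
    moreover have u: "u \<in> {0..x/2}" "\<not> dp_objective M a b N k x u < dp_objective M a b N k x (\<psi> k * x)"
      using that max(1) unfolding dp_maximizer_def is_arg_max_def by auto
    ultimately show False
      using max(2) max(3)[of u] max(1) by (simp add: dp_objective_eq[OF k x])
  qed
  moreover have "dp_maximizer M a b N k x (\<psi> k * x)"
    using max(1,2) stage_le[OF k x]
    by (auto simp: dp_maximizer_def is_arg_max_def not_less dp_objective_eq[OF k x])
  ultimately show ?thesis by blast
qed

lemma admissible_linear: "admissible_policy N (\<lambda>k x. \<psi> k * x)"
  unfolding admissible_policy_def using stage_max(1) by auto

section \<open>Expected power under an arbitrary admissible policy\<close>

context
  fixes \<pi> :: "nat \<Rightarrow> real \<Rightarrow> real" and x0 :: real
  assumes admissible: "admissible_policy N \<pi>" and x0: "0 \<le> x0"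
begin

abbreviation X :: "nat \<Rightarrow> 'w \<Rightarrow> real" where
  "X \<equiv> cascade_state a b \<pi> x0"

lemma policy:
  assumes "k < N"
  shows "\<pi> k \<in> borel_measurable borel" "\<And>y. 0 \<le> y \<Longrightarrow> \<pi> k y \<in> {0..y/2}"
  using admissible assms unfolding admissible_policy_def by auto

lemma past_determined_state: "k \<le> N \<Longrightarrow> past_determined k (X k)"
  by (rule past_determined_cascade_state) (simp add: policy(1))

text \<open>The state and the control vary with the sample point, so the induction step needs a null
  set valid for all \<open>x\<close> and \<open>u\<close> at once.\<close>

lemma AE_state_nonneg: "k \<le> N \<Longrightarrow> AE \<omega> in M. 0 \<le> X k \<omega>"
proof (induction k)
  case (Suc k)
  then have "AE \<omega> in M. 0 \<le> X k \<omega>" and k: "k < N" by auto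
  from this(1) AE_next_state_nonneg[OF k] show ?case
    by eventually_elim (use policy(2)[OF k] in auto)
qed (simp add: x0)

lemma integrable_state_cube: "k \<le> N \<Longrightarrow> integrable M (\<lambda>\<omega>. X k \<omega> ^ 3)"
proof (induction k)
  case (Suc k)
  then show ?case
    using stage_expectation(2)[OF _ past_determined_state policy(1) AE_state_nonneg policy(2), of k k]
    by simp
qed simp

lemma stage_state:
  assumes "k < N"
  shows "integrable M (\<lambda>\<omega>. (X k \<omega> - \<pi> k (X k \<omega>))\<^sup>2 * \<pi> k (X k \<omega>))"
    and "integrable M (\<lambda>\<omega>. stage k (X k \<omega>) (\<pi> k (X k \<omega>)))"
    and "expectation (\<lambda>\<omega>. stage k (X k \<omega>) (\<pi> k (X k \<omega>))) =
      expectation (\<lambda>\<omega>. (X k \<omega> - \<pi> k (X k \<omega>))\<^sup>2 * \<pi> k (X k \<omega>)) +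
      Q (Suc k) * expectation (\<lambda>\<omega>. X (Suc k) \<omega> ^ 3)"
  using stage_expectation[OF assms past_determined_state policy(1)[OF assms] AE_state_nonneg
      policy(2)[OF assms] integrable_state_cube] assms
  by auto

text \<open>An exact account of suboptimality: the expected power is \<open>Q 0 * x0 ^ 3\<close>
  minus the expected shortfalls of the stages from their optimal values. The terms
  \<open>Q k * E [x\<^sub>k\<^sup>3]\<close> telescope, and the last one vanishes because
  \<open>Q N = 0\<close>.\<close>

lemma expectation_power_sum:
  "expectation (power_sum N a b \<pi> x0) =
     Q 0 * x0 ^ 3 - (\<Sum>k<N. expectation (\<lambda>\<omega>. Q k * X k \<omega> ^ 3 - stage k (X k \<omega>) (\<pi> k (X k \<omega>))))"
proof -
  have "expectation (power_sum N a b \<pi> x0) =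
    (\<Sum>k<N. expectation (\<lambda>\<omega>. (X k \<omega> - \<pi> k (X k \<omega>))\<^sup>2 * \<pi> k (X k \<omega>)))"
    unfolding power_sum_def[abs_def] Let_def using stage_state(1) by (simp add: Bochner_Integration.integral_sum)
  also have "\<dots> = (\<Sum>k<N. (Q k * expectation (\<lambda>\<omega>. X k \<omega> ^ 3) - Q (Suc k) * expectation (\<lambda>\<omega>. X (Suc k) \<omega> ^ 3))
      - expectation (\<lambda>\<omega>. Q k * X k \<omega> ^ 3 - stage k (X k \<omega>) (\<pi> k (X k \<omega>))))"
  proof (rule sum.cong)
    fix k assume "k \<in> {..<N}"
    then have k: "k < N" by simp
    then have "expectation (\<lambda>\<omega>. Q k * X k \<omega> ^ 3 - stage k (X k \<omega>) (\<pi> k (X k \<omega>))) =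
      Q k * expectation (\<lambda>\<omega>. X k \<omega> ^ 3) - expectation (\<lambda>\<omega>. stage k (X k \<omega>) (\<pi> k (X k \<omega>)))"
      using integrable_state_cube[of k] stage_state(2)[of k] by simp
    then show "expectation (\<lambda>\<omega>. (X k \<omega> - \<pi> k (X k \<omega>))\<^sup>2 * \<pi> k (X k \<omega>)) =
      (Q k * expectation (\<lambda>\<omega>. X k \<omega> ^ 3) - Q (Suc k) * expectation (\<lambda>\<omega>. X (Suc k) \<omega> ^ 3))
      - expectation (\<lambda>\<omega>. Q k * X k \<omega> ^ 3 - stage k (X k \<omega>) (\<pi> k (X k \<omega>)))"
      using stage_state(3)[of k] k by simp
  qed simp
  also have "\<dots> = Q 0 * x0 ^ 3 - (\<Sum>k<N. expectation (\<lambda>\<omega>. Q k * X k \<omega> ^ 3 - stage k (X k \<omega>) (\<pi> k (X k \<omega>))))"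
    using sum_lessThan_telescope'[of "\<lambda>k. Q k * expectation (\<lambda>\<omega>. X k \<omega> ^ 3)" N]
    by (subst sum_subtractf) (simp add: Q_N prob_space del: cascade_state.simps(2))
  finally show ?thesis .
qed

text \<open>Each shortfall is nonnegative, since the control is feasible whenever the state is
  nonnegative.\<close>

lemma expectation_power_sum_le: "expectation (power_sum N a b \<pi> x0) \<le> Q 0 * x0 ^ 3"
proof -
  have "0 \<le> expectation (\<lambda>\<omega>. Q k * X k \<omega> ^ 3 - stage k (X k \<omega>) (\<pi> k (X k \<omega>)))" if k: "k < N" for k
  proof (rule integral_nonneg_AE)
    from AE_state_nonneg[OF less_imp_le[OF k]]
    show "AE \<omega> in M. 0 \<le> Q k * X k \<omega> ^ 3 - stage k (X k \<omega>) (\<pi> k (X k \<omega>))"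
      by eventually_elim (use stage_le[OF k] policy(2)[OF k] in auto)
  qed
  then show ?thesis
    unfolding expectation_power_sum by (auto intro!: sum_nonneg)
qed

end

section \<open>Optimality of the linear policy and the maximum farm power\<close>

lemma expectation_power_sum_linear:
  assumes "0 \<le> x0"
  shows "expectation (power_sum N a b (\<lambda>k x. \<psi> k * x) x0) = Q 0 * x0 ^ 3"
proof -
  \<comment> \<open>By homogeneity the equality extends from \<open>x = 1\<close> to every real
    \<open>x\<close>, so the shortfalls vanish identically.\<close>
  have "stage k x (\<psi> k * x) = Q k * x ^ 3" if k: "k < N" for k x
    using stage_max(2)[OF k, of 1] stage_homogeneous[of k x 1 "\<psi> k"] by (simp add: mult.commute)
  then show ?thesis
    by (simp add: expectation_power_sum[OF admissible_linear assms])
qed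

lemma linear_policy_optimal:
  assumes "0 \<le> x0"
  shows "is_arg_max (\<lambda>\<pi>. expectation (power_sum N a b \<pi> x0)) (admissible_policy N) (\<lambda>k x. \<psi> k * x)"
  using expectation_power_sum_le[OF _ assms] admissible_linear
  by (auto simp: is_arg_max_def expectation_power_sum_linear[OF assms] not_less)

text \<open>The supremum is attained at the linear policy; the factor \<open>2 * \<rho> * A\<close>
  is nonnegative and so preserves the upper bound.\<close>

lemma max_farm_power_eq:
  assumes "0 \<le> x0" "0 \<le> \<rho>" "0 \<le> A"
  shows "max_farm_power M \<rho> A N a b x0 = 2 * \<rho> * A * Q 0 * x0 ^ 3"
  unfolding max_farm_power_def
proof (rule cSup_eq_maximum)
  let ?F = "\<lambda>\<pi>. expectation (\<lambda>\<omega>. 2 * \<rho> * A * power_sum N a b \<pi> x0 \<omega>)"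
  show "2 * \<rho> * A * Q 0 * x0 ^ 3 \<in> ?F ` {\<pi>. admissible_policy N \<pi>}"
    using admissible_linear expectation_power_sum_linear[OF assms(1)]
    by (intro image_eqI[of _ _ "\<lambda>k x. \<psi> k * x"]) auto
  show "z \<le> 2 * \<rho> * A * Q 0 * x0 ^ 3" if z: "z \<in> ?F ` {\<pi>. admissible_policy N \<pi>}" for z
  proof -
    obtain \<pi> where "admissible_policy N \<pi>" "z = ?F \<pi>"
      using z by blast
    then show ?thesis
      using mult_left_mono[OF expectation_power_sum_le[OF _ assms(1)], of \<pi> "2 * \<rho> * A"] assms(2,3)
      by (simp add: mult.assoc)
  qed
qed

end

theorem theorem1:
  fixes M :: "'w measure" and N :: nat and a b :: "nat \<Rightarrow> 'w \<Rightarrow> real" and \<rho> A :: real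
    and \<mu>a \<mu>b \<Sigma>a \<Sigma>b \<Gamma>a \<Gamma>b \<psi> Q :: "nat \<Rightarrow> real"
  assumes "prob_space M" and "N \<ge> 1" and "\<rho> > 0" and "A > 0"
    and indep: "prob_space.indep_vars M (\<lambda>_. borel) (case_sum a b) ({..<N} <+> {..<N})"
    and third_moments: "\<And>k. k < N \<Longrightarrow> integrable M (\<lambda>\<omega>. a k \<omega> ^ 3)"
      "\<And>k. k < N \<Longrightarrow> integrable M (\<lambda>\<omega>. b k \<omega> ^ 3)"
    and state_nonneg: "\<And>k x u. k < N \<Longrightarrow> x \<ge> 0 \<Longrightarrow> u \<in> {0..x/2} \<Longrightarrow>
      AE \<omega> in M. 0 \<le> a k \<omega> * x + b k \<omega> * u"
    and means: "\<And>k. k < N \<Longrightarrow> \<mu>a k = prob_space.expectation M (a k)"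
      "\<And>k. k < N \<Longrightarrow> \<mu>b k = prob_space.expectation M (b k)"
    and second: "\<And>k. k < N \<Longrightarrow> \<Sigma>a k = prob_space.expectation M (\<lambda>\<omega>. a k \<omega> ^ 2)"
      "\<And>k. k < N \<Longrightarrow> \<Sigma>b k = prob_space.expectation M (\<lambda>\<omega>. b k \<omega> ^ 2)"
    and third: "\<And>k. k < N \<Longrightarrow> \<Gamma>a k = prob_space.expectation M (\<lambda>\<omega>. a k \<omega> ^ 3)"
      "\<And>k. k < N \<Longrightarrow> \<Gamma>b k = prob_space.expectation M (\<lambda>\<omega>. b k \<omega> ^ 3)"
    and Q_N: "Q N = 0"
    and \<psi>_rec: "\<And>k. k < N \<Longrightarrow> \<psi> k =
      - (3 * Q (Suc k) * \<Sigma>b k * \<mu>a k - 2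
         + sqrt ((3 * Q (Suc k) * \<Sigma>b k * \<mu>a k - 2)\<^sup>2
                 - 3 * (Q (Suc k) * \<Gamma>b k + 1) * (3 * Q (Suc k) * \<Sigma>a k * \<mu>b k + 1)))
      / (3 * (Q (Suc k) * \<Gamma>b k + 1))"
    and Q_rec: "\<And>k. k < N \<Longrightarrow> Q k =
      (1 - \<psi> k)\<^sup>2 * \<psi> k
      + Q (Suc k) * (\<Gamma>a k + \<Gamma>b k * \<psi> k ^ 3 + 3 * \<Sigma>b k * \<mu>a k * \<psi> k ^ 2 + 3 * \<Sigma>a k * \<mu>b k * \<psi> k)"
    and denom_nonzero: "\<And>k. k < N \<Longrightarrow> Q (Suc k) * \<Gamma>b k + 1 \<noteq> 0"
    and constraint_inactive: "\<And>k x u. k < N \<Longrightarrow> x > 0 \<Longrightarrow> dp_maximizer M a b N k x u \<Longrightarrow> 0 < u \<and> u < x/2"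
  shows "(\<forall>k<N. \<forall>x\<ge>0. \<forall>u. dp_maximizer M a b N k x u \<longleftrightarrow> u = \<psi> k * x)
    \<and> (\<forall>x0\<ge>0. is_arg_max (\<lambda>\<pi>. prob_space.expectation M (power_sum N a b \<pi> x0))
                 (admissible_policy N) (\<lambda>k x. \<psi> k * x))
    \<and> (\<forall>x0\<ge>0. max_farm_power M \<rho> A N a b x0 = 2 * \<rho> * A * Q 0 * x0 ^ 3)"
proof -
  interpret turbine_cascade M N a b \<mu>a \<mu>b \<Sigma>a \<Sigma>b \<Gamma>a \<Gamma>b \<psi> Q
    by (intro turbine_cascade.intro turbine_cascade_axioms.intro assms)
  show ?thesis
    using dp_maximizer_iff linear_policy_optimal max_farm_power_eq \<open>\<rho> > 0\<close> \<open>A > 0\<close> by auto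
qed

end
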